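(* Let $K$ be a field, $S=K[t_1,\ldots,t_s]$, and let $I=I(L)=(f_1,\ldots,f_s)$ be the ideal of an $s\times s$ GPCB matrix $L$ with diagonal entries $a_{i,i}$ and off-diagonal entries $-a_{i,j}$. Let $\mathbf{b}=(b_1,\ldots,b_s)$ be the vector of positive integers with $\gcd(\mathbf{b})=1$ and $L\mathbf{b}^\top=0$; if ${\rm char}(K)=p>0$, assume $p\nmid b_s$. Let $\widetilde{L}=L\,{\rm diag}(b_1,\ldots,b_s)$, with diagonal entries denoted $b_{i,i}$ and off-diagonal entries denoted $-b_{i,j}$. For $i=1,\ldots,s$, let $x_i=t_i^{a_{i,i}}$ and $y_i=\prod_{j\neq i}t_j^{a_{j,i}}$ be the two terms of $f_i$, so that $f_i=x_i-y_i$. Set $g_i=1$ and $q_i=0$ if $b_i=1$, and if $b_i>1$ set $$g_i=\sum_{j=1}^{b_i}x_i^{b_i-j}y_i^{j-1},\qquad q_i=\sum_{j=1}^{b_i-1}j\,x_i^{b_i-1-j}y_i^{j-1}.$$ For $i=1,\ldots,s$ let $b(i)=(b(i)_1,\ldots,b(i)_s)\in\mathbb{N}^s$ be defined by $b(i)_i=0$ and, for $j\neq i$, $$b(i)_j=b_{j,j}-\sum_{k}b_{j,k},$$ where $k$ runs through the indices $j+1,j+2,\ldots,i$ taken cyclically modulo $s$ in $\{1,\ldots,s\}$ (in particular $b(i)_{i+1}=0$, index mod $s$). Then, for each $i=1,\ldots,s$: (a) $g_i$ is homogeneous and $t^{b(1)}g_1f_1+\cdots+t^{b(s)}g_sf_s=0$;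 (b) $q_if_i=g_i-b_iy_i^{b_i-1}$. In particular, $b_iy_i^{b_i-1}t^{b(i)}f_i\in(f_1,\ldots,f_{i-1},f_{i+1},\ldots,f_s)+I^2$.
   Context: A GPCB (generalized positive critical binomial) matrix is an $s\times s$ integer matrix $L$ with diagonal entries $a_{i,i}>0$ and off-diagonal entries $-a_{i,j}<0$ ($i\ne j$, $a_{i,j}$ positive integers) such that $L\mathbf{b}^\top=0$ for some vector $\mathbf{b}$ of positive integers. The matrix ideal of $L$ is $I(L)=(f_1,\ldots,f_s)$, where $f_i=t_i^{a_{i,i}}-\prod_{j\ne i}t_j^{a_{j,i}}$ is the binomial defined by the $i$-th column of $L$. For a GPCB matrix $L$ there exists a vector $\mathbf{d}=(d_1,\ldots,d_s)$ of positive integers with $\mathbf{d}L=0$, unique up to scaling; "homogeneous" refers to the grading of $S$ with $\deg t_i=d_i$, for which all $f_i$ are homogeneous. $\mathbb{N}=\{0,1,\ldots\}$, $t^c=t_1^{c_1}\cdots t_s^{c_s}$. By construction $\widetilde{L}$ has zero row sums. *)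

theory Defs
  imports
    "HOL-Library.Poly_Mapping"
    "HOL-Algebra.Ideal_Product"
    "Jordan_Normal_Form.Matrix"
begin

text \<open>Rows, columns and variables are numbered \<open>0, \<dots>, s - 1\<close>, as in the matrix library;
  the index \<open>i\<close> here is \<open>i + 1\<close> in one-based notation.\<close>

section \<open>GPCB matrices\<close>

definition gpcb_matrix :: "nat \<Rightarrow> int mat \<Rightarrow> bool" where
  "gpcb_matrix s L \<longleftrightarrow>
     L \<in> carrier_mat s s \<and>
     (\<forall>i<s. L $$ (i, i) > 0) \<and>
     (\<forall>i<s. \<forall>j<s. i \<noteq> j \<longrightarrow> L $$ (i, j) < 0) \<and>
     (\<exists>b \<in> carrier_vec s. (\<forall>i<s. b $ i > 0) \<and> L *\<^sub>v b = 0\<^sub>v s)"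

text \<open>The positive integers \<open>a\<^sub>i\<^sub>,\<^sub>j\<close> in the convention that the diagonal entries of the matrix are
  \<open>a\<^sub>i\<^sub>,\<^sub>i\<close> and the off-diagonal ones are \<open>- a\<^sub>i\<^sub>,\<^sub>j\<close>.\<close>
definition unsigned_entry :: "int mat \<Rightarrow> nat \<Rightarrow> nat \<Rightarrow> int" where
  "unsigned_entry M i j = (if i = j then M $$ (i, j) else - M $$ (i, j))"

definition scaled_matrix :: "nat \<Rightarrow> int mat \<Rightarrow> int vec \<Rightarrow> int mat" where
  "scaled_matrix s L b = L * mat_diag s (\<lambda>i. b $ i)"

text \<open>The indices \<open>j + 1, j + 2, \<dots>, i\<close> taken modulo \<open>s\<close>, for \<open>i, j < s\<close> with \<open>i \<noteq> j\<close>.\<close>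
definition cyclic_interval :: "nat \<Rightarrow> nat \<Rightarrow> nat \<Rightarrow> nat set" where
  "cyclic_interval s j i = {k. k < s \<and> (if j < i then j < k \<and> k \<le> i else j < k \<or> k \<le> i)}"

text \<open>The entry \<open>b(i)\<^sub>j\<close>, as an integer; its nonnegativity is a claim about GPCB matrices.\<close>
definition shift_entry :: "nat \<Rightarrow> int mat \<Rightarrow> int vec \<Rightarrow> nat \<Rightarrow> nat \<Rightarrow> int" where
  "shift_entry s L b i j =
     (if j = i then 0
      else unsigned_entry (scaled_matrix s L b) j j
           - (\<Sum>k \<in> cyclic_interval s j i. unsigned_entry (scaled_matrix s L b) j k))"

section \<open>Polynomials\<close>

type_synonym 'k mpoly = "(nat \<Rightarrow>\<^sub>0 nat) \<Rightarrow>\<^sub>0 'k"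

text \<open>\<open>K[t\<^sub>0, \<dots>, t\<^bsub>s-1\<^esub>]\<close> as a subring of the polynomials in the variables \<open>t\<^sub>0, t\<^sub>1, \<dots>\<close>.\<close>
definition poly_ring :: "nat \<Rightarrow> 'k::field mpoly ring" where
  "poly_ring s =
     \<lparr>carrier = {p. \<forall>m \<in> Poly_Mapping.keys p. Poly_Mapping.keys m \<subseteq> {..<s}},
      monoid.mult = (*), one = 1, zero = 0, add = (+)\<rparr>"

definition var :: "nat \<Rightarrow> 'k::field mpoly" where
  "var i = Poly_Mapping.single (Poly_Mapping.single i 1) 1"

definition homogeneous :: "int vec \<Rightarrow> 'k::field mpoly \<Rightarrow> bool" where
  "homogeneous d p \<longleftrightarrow>
     (\<exists>n. \<forall>m \<in> Poly_Mapping.keys p.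
        (\<Sum>i \<in> Poly_Mapping.keys m. int (Poly_Mapping.lookup m i) * d $ i) = n)"

definition xterm :: "int mat \<Rightarrow> nat \<Rightarrow> 'k::field mpoly" where
  "xterm L i = var i ^ nat (unsigned_entry L i i)"

text \<open>The exponents come from the \<open>i\<close>-th column of \<open>L\<close>.\<close>
definition yterm :: "nat \<Rightarrow> int mat \<Rightarrow> nat \<Rightarrow> 'k::field mpoly" where
  "yterm s L i = (\<Prod>j \<in> {..<s} - {i}. var j ^ nat (unsigned_entry L j i))"

definition fpoly :: "nat \<Rightarrow> int mat \<Rightarrow> nat \<Rightarrow> 'k::field mpoly" where
  "fpoly s L i = xterm L i - yterm s L i"

definition gpoly :: "nat \<Rightarrow> int mat \<Rightarrow> int vec \<Rightarrow> nat \<Rightarrow> 'k::field mpoly" where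
  "gpoly s L b i =
     (if b $ i = 1 then 1
      else \<Sum>j = 1..nat (b $ i). xterm L i ^ (nat (b $ i) - j) * yterm s L i ^ (j - 1))"

definition qpoly :: "nat \<Rightarrow> int mat \<Rightarrow> int vec \<Rightarrow> nat \<Rightarrow> 'k::field mpoly" where
  "qpoly s L b i =
     (if b $ i = 1 then 0
      else \<Sum>j = 1..nat (b $ i) - 1.
             of_nat j * xterm L i ^ (nat (b $ i) - 1 - j) * yterm s L i ^ (j - 1))"

text \<open>The monomial with exponent vector \<open>b(i)\<close>.\<close>
definition shift_monom :: "nat \<Rightarrow> int mat \<Rightarrow> int vec \<Rightarrow> nat \<Rightarrow> 'k::field mpoly" where
  "shift_monom s L b i = (\<Prod>j<s. var j ^ nat (shift_entry s L b i j))"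

definition matrix_ideal :: "nat \<Rightarrow> int mat \<Rightarrow> 'k::field mpoly set" where
  "matrix_ideal s L = Idl\<^bsub>poly_ring s\<^esub> (fpoly s L ` {..<s})"

lemma poly_ring_cring: "cring (poly_ring s :: 'k::field mpoly ring)"
proof (rule cringI)
  let ?R = "poly_ring s :: 'k mpoly ring"
  have carrier: "p \<in> carrier ?R \<longleftrightarrow> (\<forall>m \<in> Poly_Mapping.keys p. Poly_Mapping.keys m \<subseteq> {..<s})" for p
    by (simp add: poly_ring_def)
  have ops: "x \<otimes>\<^bsub>?R\<^esub> y = x * y" "x \<oplus>\<^bsub>?R\<^esub> y = x + y" "\<one>\<^bsub>?R\<^esub> = 1" "\<zero>\<^bsub>?R\<^esub> = 0" for x y
    by (simp_all add: poly_ring_def)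
  have add: "p + q \<in> carrier ?R" if "p \<in> carrier ?R" "q \<in> carrier ?R" for p q
    using that Poly_Mapping.keys_add[of p q] unfolding carrier by blast
  have mult: "p * q \<in> carrier ?R" if pq: "p \<in> carrier ?R" "q \<in> carrier ?R" for p q
    unfolding carrier
  proof (intro ballI subsetI)
    fix m x assume m: "m \<in> Poly_Mapping.keys (p * q)" and x: "x \<in> Poly_Mapping.keys m"
    from m keys_mult[of p q] obtain u v
      where "u \<in> Poly_Mapping.keys p" "v \<in> Poly_Mapping.keys q" "m = u + v" by blast
    with pq x Poly_Mapping.keys_add[of u v] show "x \<in> {..<s}" unfolding carrier by blast
  qed
  have zero: "0 \<in> carrier ?R" and one: "1 \<in> carrier ?R"
    unfolding carrier by simp_all
  have uminus: "- p \<in> carrier ?R" if "p \<in> carrier ?R" for p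
    using that unfolding carrier by simp
  show "abelian_group ?R"
  proof (rule abelian_groupI, unfold ops)
    fix x assume "x \<in> carrier ?R"
    then show "\<exists>y \<in> carrier ?R. y + x = 0"
      using uminus[of x] by (intro bexI[of _ "- x"]) (rule left_minus)
  qed (use add zero in \<open>simp_all add: add.assoc add.commute\<close>)
  show "Group.comm_monoid ?R"
    by (rule comm_monoidI, unfold ops) (use mult one in \<open>simp_all add: mult.assoc mult.commute\<close>)
  show "(x \<oplus>\<^bsub>?R\<^esub> y) \<otimes>\<^bsub>?R\<^esub> z = x \<otimes>\<^bsub>?R\<^esub> z \<oplus>\<^bsub>?R\<^esub> y \<otimes>\<^bsub>?R\<^esub> z" for x y z
    unfolding ops by (rule distrib_right)
qed

end

theory Submission
  imports Defs
begin

text \<open>Multiplying \<open>t\<^sup>b\<^sup>(\<^sup>i\<^sup>) g\<^sub>i f\<^sub>i\<close> out gives a difference of two monomials, because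
  \<open>g\<^sub>i f\<^sub>i = x\<^sub>i\<close> and \<open>y\<^sub>i\<close> raised to \<open>b\<^sub>i\<close> and subtracted.  The exponents \<open>b(i)\<close> are chosen so that
  the negative monomial for the cyclic successor of \<open>i\<close> equals the positive monomial for \<open>i\<close>; hence
  the sum over all \<open>i\<close> telescopes around the cycle.  Solving this relation for its \<open>i\<close>-th summand
  and replacing \<open>g\<^sub>i\<close> by \<open>q\<^sub>i f\<^sub>i + b\<^sub>i y\<^sub>i\<^bsup>b\<^sub>i - 1\<^esup>\<close> gives the membership statement.\<close>

section \<open>Power sums\<close>

lemma power_sum_times_diff:
  fixes x y :: "'a::comm_ring_1"
  shows "(\<Sum>j = 1..n. x ^ (n - j) * y ^ (j - 1)) * (x - y) = x ^ n - y ^ n"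
proof (induction n)
  case (Suc n)
  \<comment> \<open>For \<open>j \<le> n\<close> each summand gains one factor \<open>x\<close>, as
    \<open>Suc n - j = Suc (n - j)\<close>; the new summand at \<open>j = Suc n\<close> is
    \<open>y ^ n\<close>.\<close>
  have "(\<Sum>j = 1..n. x ^ (Suc n - j) * y ^ (j - 1)) = x * (\<Sum>j = 1..n. x ^ (n - j) * y ^ (j - 1))"
    by (simp add: sum_distrib_left mult.assoc Suc_diff_le)
  then have "(\<Sum>j = 1..Suc n. x ^ (Suc n - j) * y ^ (j - 1)) * (x - y)
      = x * ((\<Sum>j = 1..n. x ^ (n - j) * y ^ (j - 1)) * (x - y)) + y ^ n * (x - y)"
    by (simp add: algebra_simps)
  then show ?case
    unfolding Suc.IH by (simp add: algebra_simps)
qed simp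

text \<open>The unweighted sum minus \<open>of_nat (Suc m) * y ^ m\<close> vanishes at
  \<open>x = y\<close>; the weighted sum is its formal quotient by \<open>x - y\<close>.\<close>

lemma weighted_power_sum_times_diff:
  fixes x y :: "'a::comm_ring_1"
  shows "(\<Sum>j = 1..m. of_nat j * x ^ (m - j) * y ^ (j - 1)) * (x - y)
    = (\<Sum>j = 1..Suc m. x ^ (Suc m - j) * y ^ (j - 1)) - of_nat (Suc m) * y ^ m"
proof (induction m)
  case (Suc m)
  let ?Q = "\<lambda>m. \<Sum>j = 1..m. of_nat j * x ^ (m - j) * y ^ (j - 1)"
  let ?G = "\<lambda>m. \<Sum>j = 1..m. x ^ (m - j) * y ^ (j - 1)"
  \<comment> \<open>Both sums obey the same kind of recursion: \<open>x\<close> times the previous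
    sum plus one last term. This reduces the claim to the induction hypothesis.\<close>
  have "(\<Sum>j = 1..m. of_nat j * x ^ (Suc m - j) * y ^ (j - 1)) = x * ?Q m"
    by (simp add: sum_distrib_left mult_ac Suc_diff_le)
  then have Q: "?Q (Suc m) = x * ?Q m + of_nat (Suc m) * y ^ m"
    by simp
  have "(\<Sum>j = 1..Suc m. x ^ (Suc (Suc m) - j) * y ^ (j - 1)) = x * ?G (Suc m)"
    unfolding sum_distrib_left by (intro sum.cong) (auto simp: Suc_diff_le)
  then have G: "?G (Suc (Suc m)) = x * ?G (Suc m) + y ^ Suc m"
    by (subst sum.cl_ivl_Suc) simp
  have "?Q (Suc m) * (x - y) = x * (?Q m * (x - y)) + of_nat (Suc m) * y ^ m * (x - y)"
    unfolding Q by (simp add: algebra_simps)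
  also have "\<dots> = x * ?G (Suc m) - of_nat (Suc m) * y ^ Suc m"
    unfolding Suc.IH by (simp add: algebra_simps)
  also have "\<dots> = ?G (Suc (Suc m)) - of_nat (Suc (Suc m)) * y ^ Suc m"
    unfolding G by (simp add: algebra_simps)
  finally show ?case .
qed simp

section \<open>Graded polynomials\<close>

definition weight :: "int vec \<Rightarrow> (nat \<Rightarrow>\<^sub>0 nat) \<Rightarrow> int" where
  "weight d m = (\<Sum>i \<in> Poly_Mapping.keys m. int (Poly_Mapping.lookup m i) * d $ i)"

text \<open>\<open>homogeneous\<close> hides the degree behind an existential quantifier; sums need
  a common explicit one. The zero polynomial has every degree.\<close>

definition homogeneous_of_degree :: "int vec \<Rightarrow> int \<Rightarrow> 'k::field mpoly \<Rightarrow> bool" where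
  "homogeneous_of_degree d n p \<longleftrightarrow> (\<forall>m \<in> Poly_Mapping.keys p. weight d m = n)"

text \<open>Puts monomials with different supports on one index set, which gives additivity of the
  weight.\<close>

lemma weight_superset:
  assumes "finite A" "Poly_Mapping.keys m \<subseteq> A"
  shows "weight d m = (\<Sum>i \<in> A. int (Poly_Mapping.lookup m i) * d $ i)"
  unfolding weight_def using assms by (intro sum.mono_neutral_left) (auto simp: in_keys_iff)

lemma weight_add: "weight d (m + n) = weight d m + weight d n"
proof -
  let ?A = "Poly_Mapping.keys m \<union> Poly_Mapping.keys n"
  have "Poly_Mapping.keys (m + n) \<subseteq> ?A"
    by (rule Poly_Mapping.keys_add)
  then show ?thesis
    by (simp add: weight_superset[of ?A] lookup_add sum.distrib algebra_simps)
qed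

lemma homogeneous_of_degree_mult:
  assumes "homogeneous_of_degree d m p" "homogeneous_of_degree d n q"
  shows "homogeneous_of_degree d (m + n) (p * q)"
  using assms keys_mult[of p q] unfolding homogeneous_of_degree_def by (force simp: weight_add)

lemma homogeneous_of_degree_one: "homogeneous_of_degree d 0 1"
  by (simp add: homogeneous_of_degree_def weight_def)

lemma homogeneous_of_degree_var: "homogeneous_of_degree d (d $ i) (var i)"
  by (simp add: homogeneous_of_degree_def weight_def var_def)

lemma homogeneous_of_degree_power:
  assumes "homogeneous_of_degree d n p"
  shows "homogeneous_of_degree d (int k * n) (p ^ k)"
proof (induction k)
  case (Suc k)
  show ?case
    using homogeneous_of_degree_mult[OF assms Suc] by (simp add: algebra_simps)
qed (simp add: homogeneous_of_degree_one)

lemma homogeneous_of_degree_prod: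
  assumes "finite A" "\<And>a. a \<in> A \<Longrightarrow> homogeneous_of_degree d (n a) (p a)"
  shows "homogeneous_of_degree d (\<Sum>a \<in> A. n a) (\<Prod>a \<in> A. p a)"
  using assms
  by (induction A) (auto simp: homogeneous_of_degree_one intro: homogeneous_of_degree_mult)

lemma homogeneous_of_degree_sum:
  assumes "\<And>a. a \<in> A \<Longrightarrow> homogeneous_of_degree d n (p a)"
  shows "homogeneous_of_degree d n (\<Sum>a \<in> A. p a)"
  using assms
proof (induction A rule: infinite_finite_induct)
  case (insert a A)
  then show ?case
    using Poly_Mapping.keys_add[of "p a" "sum p A"]
    by (auto simp: homogeneous_of_degree_def)
qed (simp_all add: homogeneous_of_degree_def)

lemma homogeneous_of_degree_imp_homogeneous:
  "homogeneous_of_degree d n p \<Longrightarrow> homogeneous d p"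
  unfolding homogeneous_of_degree_def homogeneous_def weight_def by blast

section \<open>The polynomial ring and its ideals\<close>

lemma poly_ring_simps:
  "x \<otimes>\<^bsub>poly_ring s\<^esub> y = x * y" "x \<oplus>\<^bsub>poly_ring s\<^esub> y = x + y"
  "\<one>\<^bsub>poly_ring s\<^esub> = 1" "\<zero>\<^bsub>poly_ring s\<^esub> = 0"
  by (simp_all add: poly_ring_def)

lemma poly_ring_one_closed: "1 \<in> carrier (poly_ring s)"
  by (simp add: poly_ring_def)

lemma poly_ring_zero_closed: "0 \<in> carrier (poly_ring s)"
  by (simp add: poly_ring_def)

lemma poly_ring_mult_closed:
  "p \<in> carrier (poly_ring s) \<Longrightarrow> q \<in> carrier (poly_ring s) \<Longrightarrow> p * q \<in> carrier (poly_ring s)"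
  using cring.cring_simprules(5)[OF poly_ring_cring, of p s q] by (simp add: poly_ring_simps)

lemma poly_ring_add_closed:
  "p \<in> carrier (poly_ring s) \<Longrightarrow> q \<in> carrier (poly_ring s) \<Longrightarrow> p + q \<in> carrier (poly_ring s)"
  using cring.cring_simprules(1)[OF poly_ring_cring, of p s q] by (simp add: poly_ring_simps)

lemma poly_ring_uminus_closed: "p \<in> carrier (poly_ring s) \<Longrightarrow> - p \<in> carrier (poly_ring s)"
  by (simp add: poly_ring_def)

lemma poly_ring_diff_closed:
  "p \<in> carrier (poly_ring s) \<Longrightarrow> q \<in> carrier (poly_ring s) \<Longrightarrow> p - q \<in> carrier (poly_ring s)"
  using poly_ring_add_closed[of p s "- q"] by (simp add: poly_ring_uminus_closed)

lemma poly_ring_power_closed: "p \<in> carrier (poly_ring s) \<Longrightarrow> p ^ n \<in> carrier (poly_ring s)"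
  by (induction n) (simp_all add: poly_ring_one_closed poly_ring_mult_closed)

lemma poly_ring_of_nat_closed: "of_nat n \<in> carrier (poly_ring s)"
  by (induction n)
    (simp_all add: poly_ring_zero_closed poly_ring_one_closed poly_ring_add_closed)

lemma poly_ring_sum_closed:
  "(\<And>a. a \<in> A \<Longrightarrow> p a \<in> carrier (poly_ring s)) \<Longrightarrow> sum p A \<in> carrier (poly_ring s)"
  by (induction A rule: infinite_finite_induct)
    (simp_all add: poly_ring_zero_closed poly_ring_add_closed)

lemma poly_ring_prod_closed:
  "(\<And>a. a \<in> A \<Longrightarrow> p a \<in> carrier (poly_ring s)) \<Longrightarrow> prod p A \<in> carrier (poly_ring s)"
  by (induction A rule: infinite_finite_induct)
    (simp_all add: poly_ring_one_closed poly_ring_mult_closed)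

lemma poly_ring_var_closed: "i < s \<Longrightarrow> var i \<in> carrier (poly_ring s)"
  by (simp add: poly_ring_def var_def)

lemmas poly_ring_closed =
  poly_ring_one_closed poly_ring_zero_closed poly_ring_mult_closed poly_ring_uminus_closed
  poly_ring_diff_closed poly_ring_power_closed poly_ring_of_nat_closed poly_ring_sum_closed
  poly_ring_prod_closed poly_ring_var_closed

lemma xterm_closed: "i < s \<Longrightarrow> xterm L i \<in> carrier (poly_ring s)"
  unfolding xterm_def by (intro poly_ring_closed)

lemma yterm_closed: "yterm s L i \<in> carrier (poly_ring s)"
  unfolding yterm_def by (intro poly_ring_closed) simp

lemma fpoly_closed: "i < s \<Longrightarrow> fpoly s L i \<in> carrier (poly_ring s)"
  unfolding fpoly_def by (intro poly_ring_closed xterm_closed yterm_closed)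

lemma gpoly_closed: "i < s \<Longrightarrow> gpoly s L b i \<in> carrier (poly_ring s)"
  unfolding gpoly_def
  by (auto intro!: poly_ring_closed intro: xterm_closed yterm_closed)

lemma qpoly_closed: "i < s \<Longrightarrow> qpoly s L b i \<in> carrier (poly_ring s)"
  unfolding qpoly_def
  by (auto intro!: poly_ring_closed intro: xterm_closed yterm_closed)

lemma shift_monom_closed: "shift_monom s L b i \<in> carrier (poly_ring s)"
  unfolding shift_monom_def by (intro poly_ring_closed) simp

text \<open>Transfers closure under linear combinations from the record operations to
  \<open>*\<close> and \<open>+\<close>; over an infinite \<open>A\<close> the sum is 0.\<close>

lemma ideal_sum_mult_mem:
  assumes I: "ideal I (poly_ring s :: 'k::field mpoly ring)"
    and c: "\<And>a. a \<in> A \<Longrightarrow> c a \<in> carrier (poly_ring s)" and f: "\<And>a. a \<in> A \<Longrightarrow> f a \<in> I"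
  shows "(\<Sum>a \<in> A. c a * f a) \<in> I"
  using c f
proof (induction A rule: infinite_finite_induct)
  case (insert a A)
  have "c a * f a \<in> I"
    using ideal.I_l_closed[OF I, of "f a" "c a"] insert.prems by (simp add: poly_ring_simps)
  then show ?case
    using insert additive_subgroup.a_closed[OF ideal.axioms(1)[OF I], of "c a * f a"]
    by (simp add: poly_ring_simps)
qed (use additive_subgroup.zero_closed[OF ideal.axioms(1)[OF I]]
  in \<open>simp_all add: poly_ring_simps\<close>)

section \<open>Monomials of a GPCB matrix\<close>

text \<open>The separate value at \<open>b $ i = 1\<close> agrees with the general formula, whose
  only summand is then a product of zeroth powers. For \<open>qpoly\<close> the sum is empty
  there.\<close>

lemma gpoly_eq_sum:
  "gpoly s L b i = (\<Sum>j = 1..nat (b $ i). xterm L i ^ (nat (b $ i) - j) * yterm s L i ^ (j - 1))"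
  by (simp add: gpoly_def)

lemma qpoly_eq_sum:
  "qpoly s L b i = (\<Sum>j = 1..nat (b $ i) - 1.
     of_nat j * xterm L i ^ (nat (b $ i) - 1 - j) * yterm s L i ^ (j - 1))"
  by (simp add: qpoly_def)

lemma gpoly_mult_fpoly:
  "gpoly s L b i * fpoly s L i = xterm L i ^ nat (b $ i) - yterm s L i ^ nat (b $ i)"
  unfolding gpoly_eq_sum fpoly_def by (rule power_sum_times_diff)

lemma qpoly_mult_fpoly:
  assumes "b $ i > 0"
  shows "qpoly s L b i * fpoly s L i
    = gpoly s L b i - of_int (b $ i) * yterm s L i ^ (nat (b $ i) - 1)"
proof -
  \<comment> \<open>Positivity makes \<open>nat (b $ i) - 1\<close> an exact predecessor, the
    \<open>m\<close> of the weighted identity.\<close>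
  obtain m where m: "nat (b $ i) = Suc m"
    using assms by (cases "nat (b $ i)") auto
  then have "b $ i = int (Suc m)"
    by simp
  then have "(of_int (b $ i) :: 'a mpoly) = of_nat (Suc m)"
    by (simp only: of_int_of_nat_eq)
  then show ?thesis
    unfolding qpoly_eq_sum gpoly_eq_sum fpoly_def m
    using weighted_power_sum_times_diff[where m = m and x = "xterm L i" and y = "yterm s L i"]
    by simp
qed

section \<open>Cyclic successors and cyclic intervals\<close>

lemma sum_cyclic_shift:
  fixes F :: "nat \<Rightarrow> 'a::comm_monoid_add"
  assumes "s > 0"
  shows "(\<Sum>j<s. F ((j + 1) mod s)) = (\<Sum>j<s. F j)"
proof -
  obtain n where s: "s = Suc n"
    using assms by (cases s) auto
  \<comment> \<open>Only the last index \<open>n\<close> wraps around, to 0; it supplies the term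
    that \<open>sum.lessThan_Suc_shift\<close> splits off at the front.\<close>
  have "(\<Sum>j<n. F ((j + 1) mod s)) = (\<Sum>j<n. F (Suc j))"
    by (intro sum.cong) (auto simp: s)
  then show ?thesis
    unfolding s sum.lessThan_Suc_shift[of F] by (simp add: s add.commute)
qed

text \<open>Walking on from \<open>j\<close> visits one new index, unless the walk starts at
  \<open>j\<close> or would return to its start \<open>k\<close>. The next two lemmas treat these
  exceptions: a single index, and the whole circle without its start.\<close>

lemma cyclic_interval_succ:
  assumes "j < s" "k < s" "k \<noteq> j" "k \<noteq> (j + 1) mod s"
  shows "cyclic_interval s k ((j + 1) mod s) = insert ((j + 1) mod s) (cyclic_interval s k j)"
    and "(j + 1) mod s \<notin> cyclic_interval s k j"
  using assms by (cases "j + 1 = s"; auto simp: cyclic_interval_def split: if_splits)+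

lemma cyclic_interval_self_succ:
  assumes "j < s" "s > 1"
  shows "cyclic_interval s j ((j + 1) mod s) = {(j + 1) mod s}"
  using assms by (cases "j + 1 = s"; auto simp: cyclic_interval_def)

lemma cyclic_interval_succ_self:
  assumes "j < s" "s > 1"
  shows "cyclic_interval s ((j + 1) mod s) j = {..<s} - {(j + 1) mod s}"
  using assms by (cases "j + 1 = s"; auto simp: cyclic_interval_def)

lemma cyclic_interval_subset: "k < s \<Longrightarrow> k \<noteq> j \<Longrightarrow> cyclic_interval s k j \<subseteq> {..<s} - {k}"
  by (auto simp: cyclic_interval_def split: if_splits)

text \<open>\<open>gpcb_matrix\<close> only asserts that some positive kernel vector exists; here
  the one that scales the columns is fixed.\<close>

locale gpcb_kernel =
  fixes s :: nat and L :: "int mat" and b :: "int vec"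
  assumes gpcb: "gpcb_matrix s L"
    and b_carrier: "b \<in> carrier_vec s"
    and b_pos: "i < s \<Longrightarrow> b $ i > 0"
    and kernel: "L *\<^sub>v b = 0\<^sub>v s"
begin

abbreviation "scaled_entry \<equiv> unsigned_entry (scaled_matrix s L b)"

abbreviation "succ j \<equiv> (j + 1) mod s"

section \<open>Signs and row sums of the scaled matrix\<close>

lemma L_carrier: "L \<in> carrier_mat s s"
  using gpcb by (simp add: gpcb_matrix_def)

lemma unsigned_entry_pos: "i < s \<Longrightarrow> j < s \<Longrightarrow> unsigned_entry L i j > 0"
  using gpcb by (auto simp: gpcb_matrix_def unsigned_entry_def)

lemma scaled_matrix_entry:
  "i < s \<Longrightarrow> j < s \<Longrightarrow> scaled_matrix s L b $$ (i, j) = L $$ (i, j) * b $ j"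
  unfolding scaled_matrix_def using L_carrier by (subst mat_diag_mult_right) auto

lemma scaled_entry: "i < s \<Longrightarrow> j < s \<Longrightarrow> scaled_entry i j = unsigned_entry L i j * b $ j"
  by (simp add: unsigned_entry_def scaled_matrix_entry)

lemma scaled_entry_pos: "i < s \<Longrightarrow> j < s \<Longrightarrow> scaled_entry i j > 0"
  by (simp add: scaled_entry unsigned_entry_pos b_pos)

lemma nat_scaled_entry:
  "i < s \<Longrightarrow> j < s \<Longrightarrow> nat (scaled_entry i j) = nat (unsigned_entry L i j) * nat (b $ j)"
  using unsigned_entry_pos[of i j] by (simp add: scaled_entry nat_mult_distrib)

text \<open>This is row \<open>i\<close> of \<open>L *\<^sub>v b = 0\<^sub>v s\<close> with the
  negative off-diagonal terms moved to the other side.\<close>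

lemma scaled_row_sum:
  assumes i: "i < s"
  shows "(\<Sum>k \<in> {..<s} - {i}. scaled_entry i k) = scaled_entry i i"
proof -
  have "0 = (L *\<^sub>v b) $ i"
    using kernel i by simp
  also have "\<dots> = (\<Sum>k<s. L $$ (i, k) * b $ k)"
    using L_carrier b_carrier i by (auto simp: scalar_prod_def atLeast0LessThan)
  also have "\<dots> = L $$ (i, i) * b $ i + (\<Sum>k \<in> {..<s} - {i}. L $$ (i, k) * b $ k)"
    using i by (subst sum.remove[of _ i]) auto
  also have "(\<Sum>k \<in> {..<s} - {i}. L $$ (i, k) * b $ k) = - (\<Sum>k \<in> {..<s} - {i}. scaled_entry i k)"
    unfolding sum_negf[symmetric]
    by (intro sum.cong) (use i in \<open>auto simp: scaled_matrix_entry unsigned_entry_def\<close>)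
  also have "L $$ (i, i) * b $ i = scaled_entry i i"
    using i by (simp add: scaled_matrix_entry unsigned_entry_def)
  finally show ?thesis
    by simp
qed

text \<open>With a single index, the positive diagonal entry would equal an empty row sum.\<close>

lemma size_gt_one:
  assumes "i < s"
  shows "s > 1"
proof (rule ccontr)
  assume "\<not> s > 1"
  with assms have "{..<s} - {i} = {}"
    by auto
  with scaled_row_sum[OF assms] scaled_entry_pos[OF assms assms] show False
    by simp
qed

section \<open>The exponent vectors b(i) and their change along the cycle\<close>

lemma succ_less: "i < s \<Longrightarrow> succ i < s"
  by simp

lemma succ_neq: "i < s \<Longrightarrow> succ i \<noteq> i"
  using size_gt_one[of i] by (cases "i + 1 = s") auto

text \<open>The subtracted entries are positive and form part of the off-diagonal row, whose total
  is the diagonal entry. Hence \<open>nat\<close> truncates nothing in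
  \<open>shift_monom\<close>.\<close>

lemma shift_entry_nonneg:
  assumes "i < s" "j < s"
  shows "shift_entry s L b i j \<ge> 0"
proof (cases "j = i")
  case False
  have "(\<Sum>k \<in> cyclic_interval s j i. scaled_entry j k) \<le> (\<Sum>k \<in> {..<s} - {j}. scaled_entry j k)"
    using cyclic_interval_subset[OF assms(2) False] scaled_entry_pos[OF assms(2)]
    by (intro sum_mono2) (auto intro: less_imp_le)
  then show ?thesis
    using False scaled_row_sum[OF assms(2)] by (simp add: shift_entry_def)
qed (simp add: shift_entry_def)

text \<open>The interval from \<open>succ i\<close> round to \<open>i\<close> misses only its start,
  so the full row sum is subtracted.\<close>

lemma shift_entry_succ_self:
  assumes "i < s"
  shows "shift_entry s L b i (succ i) = 0"
  using succ_neq[OF assms] scaled_row_sum[OF succ_less[OF assms]]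
  unfolding shift_entry_def cyclic_interval_succ_self[OF assms size_gt_one[OF assms]] by simp

lemma shift_entry_self_succ:
  assumes "i < s"
  shows "shift_entry s L b (succ i) i + scaled_entry i (succ i) = scaled_entry i i"
  using succ_neq[OF assms]
  unfolding shift_entry_def cyclic_interval_self_succ[OF assms size_gt_one[OF assms]] by simp

text \<open>Extending the interval by \<open>succ i\<close> subtracts exactly one more
  entry.\<close>

lemma shift_entry_succ:
  assumes "i < s" "k < s" "k \<noteq> i" "k \<noteq> succ i"
  shows "shift_entry s L b (succ i) k + scaled_entry k (succ i) = shift_entry s L b i k"
proof -
  have "finite (cyclic_interval s k i)"
    by (simp add: cyclic_interval_def)
  then show ?thesis
    using assms cyclic_interval_succ[OF assms] by (simp add: shift_entry_def)
qed

text \<open>Here and for \<open>yterm\<close>, a product over all variables, with exponent 0 where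
  one is absent, allows comparison variable by variable.\<close>

lemma xterm_power:
  "i < s \<Longrightarrow> xterm L i ^ nat (b $ i) = (\<Prod>k<s. var k ^ (if k = i then nat (scaled_entry i i) else 0))"
  by (subst prod.remove[of _ i]) (simp_all add: xterm_def nat_scaled_entry power_mult)

lemma yterm_power:
  assumes "i < s"
  shows "yterm s L i ^ nat (b $ i)
    = (\<Prod>k<s. var k ^ (if k = i then 0 else nat (scaled_entry k i)))"
proof -
  have "yterm s L i ^ nat (b $ i) = (\<Prod>k \<in> {..<s} - {i}. var k ^ nat (scaled_entry k i))"
    using assms by (simp add: yterm_def prod_power_distrib[symmetric] nat_scaled_entry power_mult)
  then show ?thesis
    using assms by (subst prod.remove[of _ i]) simp_all
qed

lemma shift_monom_succ:
  assumes i: "i < s"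
  shows "shift_monom s L b (succ i) * yterm s L (succ i) ^ nat (b $ succ i)
    = shift_monom s L b i * xterm L i ^ nat (b $ i)"
proof -
  have "nat (shift_entry s L b (succ i) k) + (if k = succ i then 0 else nat (scaled_entry k (succ i)))
      = nat (shift_entry s L b i k) + (if k = i then nat (scaled_entry i i) else 0)"
    if k: "k < s" for k
  proof -
    \<comment> \<open>These signs carry the integer identities for exponents over to their
      \<open>nat\<close> values.\<close>
    note nonneg = shift_entry_nonneg[OF i k] shift_entry_nonneg[OF succ_less[OF i] k]
      scaled_entry_pos[OF k succ_less[OF i]]
    consider "k = succ i" | "k = i" | "k \<noteq> i" "k \<noteq> succ i"
      by blast
    then show ?thesis
    proof cases
      \<comment> \<open>Both sides are 0: b(\<open>succ i\<close>) vanishes at its own index by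
        definition, and b(\<open>i\<close>) vanishes at \<open>succ i\<close>.\<close>
      case 1
      then show ?thesis
        using shift_entry_succ_self[OF i] succ_neq[OF i] by (simp add: shift_entry_def)
    next
      case 2
      have "shift_entry s L b i i = 0"
        by (simp add: shift_entry_def)
      with 2 show ?thesis
        using shift_entry_self_succ[OF i] succ_neq[OF i] nonneg by simp
    next
      case 3
      then show ?thesis
        using shift_entry_succ[OF i k 3] nonneg by simp
    qed
  qed
  then show ?thesis
    unfolding shift_monom_def xterm_power[OF i] yterm_power[OF succ_less[OF i]]
      prod.distrib[symmetric] power_add[symmetric]
    by (intro prod.cong) auto
qed

lemma relation:
  "(\<Sum>j<s. shift_monom s L b j * gpoly s L b j * fpoly s L j) = (0 :: 'k::field mpoly)"
\<comment> \<open>The cyclic reindexing needs a nonempty index set; for \<open>s = 0\<close> the sum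
  is empty.\<close>
proof (cases "s = 0")
  case False
  let ?X = "\<lambda>j. shift_monom s L b j * xterm L j ^ nat (b $ j) :: 'k mpoly"
  let ?Y = "\<lambda>j. shift_monom s L b j * yterm s L j ^ nat (b $ j) :: 'k mpoly"
  have "(\<Sum>j<s. ?X j) = (\<Sum>j<s. ?Y (succ j))"
    by (intro sum.cong) (simp_all only: shift_monom_succ lessThan_iff)
  also have "\<dots> = (\<Sum>j<s. ?Y j)"
    using False by (intro sum_cyclic_shift) simp
  finally show ?thesis
    by (simp add: mult.assoc gpoly_mult_fpoly right_diff_distrib sum_subtractf)
qed simp

text \<open>Column \<open>i\<close> of the equation dL = 0 says that \<open>xterm\<close> and
  \<open>yterm\<close> have the same degree \<open>n\<close>, so every summand of
  \<open>gpoly\<close> has degree \<open>n\<close> times one less than \<open>b $ i\<close>.\<close>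

lemma homogeneous_gpoly:
  assumes d: "d \<in> carrier_vec s" "transpose_mat L *\<^sub>v d = 0\<^sub>v s" and i: "i < s"
  shows "homogeneous d (gpoly s L b i :: 'k::field mpoly)"
proof -
  define n where "n = unsigned_entry L i i * d $ i"
  have "0 = (transpose_mat L *\<^sub>v d) $ i"
    using d i by simp
  also have "\<dots> = (\<Sum>k<s. L $$ (k, i) * d $ k)"
    using L_carrier d(1) i by (auto simp: scalar_prod_def atLeast0LessThan)
  also have "\<dots> = n + (\<Sum>k \<in> {..<s} - {i}. L $$ (k, i) * d $ k)"
    using i by (subst sum.remove[of _ i]) (auto simp: n_def unsigned_entry_def)
  also have "(\<Sum>k \<in> {..<s} - {i}. L $$ (k, i) * d $ k)
      = - (\<Sum>k \<in> {..<s} - {i}. unsigned_entry L k i * d $ k)"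
    unfolding sum_negf[symmetric] by (intro sum.cong) (auto simp: unsigned_entry_def)
  finally have n: "(\<Sum>k \<in> {..<s} - {i}. unsigned_entry L k i * d $ k) = n"
    by simp
  have x: "homogeneous_of_degree d n (xterm L i :: 'k mpoly)"
    using homogeneous_of_degree_power[OF homogeneous_of_degree_var,
        of d "nat (unsigned_entry L i i)" i] unsigned_entry_pos[OF i i]
    by (simp add: xterm_def n_def)
  have "homogeneous_of_degree d
      (\<Sum>k \<in> {..<s} - {i}. int (nat (unsigned_entry L k i)) * d $ k) (yterm s L i :: 'k mpoly)"
    unfolding yterm_def
    by (intro homogeneous_of_degree_prod homogeneous_of_degree_power homogeneous_of_degree_var) simp
  also have "(\<Sum>k \<in> {..<s} - {i}. int (nat (unsigned_entry L k i)) * d $ k) = n"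
    unfolding n[symmetric] using unsigned_entry_pos[OF _ i]
    by (intro sum.cong) (auto simp: less_imp_le)
  finally have y: "homogeneous_of_degree d n (yterm s L i :: 'k mpoly)" .
  have "homogeneous_of_degree d (int (nat (b $ i) - 1) * n)
      (xterm L i ^ (nat (b $ i) - j) * yterm s L i ^ (j - 1) :: 'k mpoly)"
    if "j \<in> {1..nat (b $ i)}" for j
  proof -
    \<comment> \<open>The two exponents add up to \<open>nat (b $ i) - 1\<close> for every
      \<open>j\<close>; the range of \<open>j\<close> makes both subtractions exact.\<close>
    have "int (nat (b $ i) - 1) * n = int (nat (b $ i) - j) * n + int (j - 1) * n"
      using that unfolding distrib_right[symmetric] by auto
    then show ?thesis
      by (simp only:) (intro homogeneous_of_degree_mult homogeneous_of_degree_power x y)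
  qed
  then show ?thesis
    unfolding gpoly_eq_sum
    by (intro homogeneous_of_degree_imp_homogeneous homogeneous_of_degree_sum)
qed

lemma membership:
  assumes i: "i < s"
  shows "(of_int (b $ i) * yterm s L i ^ (nat (b $ i) - 1) * shift_monom s L b i * fpoly s L i
       :: 'k::field mpoly) \<in>
      Idl\<^bsub>poly_ring s\<^esub> (fpoly s L ` ({..<s} - {i}))
      <+>\<^bsub>poly_ring s\<^esub>
      (matrix_ideal s L \<cdot>\<^bsub>poly_ring s\<^esub> matrix_ideal s L)"
proof -
  let ?R = "poly_ring s :: 'k mpoly ring"
  let ?f = "fpoly s L :: nat \<Rightarrow> 'k mpoly"
  let ?t = "shift_monom s L b :: nat \<Rightarrow> 'k mpoly"
  let ?g = "gpoly s L b :: nat \<Rightarrow> 'k mpoly"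
  let ?q = "qpoly s L b i :: 'k mpoly"
  let ?J = "Idl\<^bsub>?R\<^esub> (?f ` ({..<s} - {i}))"
  let ?I = "matrix_ideal s L :: 'k mpoly set"
  interpret cring ?R
    by (rule poly_ring_cring)
  have sub: "?f ` ({..<s} - {i}) \<subseteq> carrier ?R" "?f ` {..<s} \<subseteq> carrier ?R"
    by (auto intro: fpoly_closed)
  have J: "ideal ?J ?R" and I: "ideal ?I ?R"
    unfolding matrix_ideal_def using sub by (auto intro: genideal_ideal)
  have fJ: "?f j \<in> ?J" if "j \<in> {..<s} - {i}" for j
    using genideal_self[OF sub(1)] that by blast
  have fI: "?f i \<in> ?I"
    using genideal_self[OF sub(2)] i unfolding matrix_ideal_def by blast
  have "(\<Sum>j \<in> {..<s} - {i}. - (?t j * ?g j) * ?f j) \<in> ?J"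
    by (intro ideal_sum_mult_mem[OF J] fJ poly_ring_closed shift_monom_closed gpoly_closed) auto
  \<comment> \<open>One factor \<open>?f i\<close> absorbs the coefficient inside the ideal; the
    other stays as second factor of the ideal product.\<close>
  moreover have "(- (?t i * ?q) * ?f i) * ?f i \<in> ?I \<cdot>\<^bsub>?R\<^esub> ?I"
  proof -
    have "- (?t i * ?q) \<in> carrier ?R"
      by (intro poly_ring_closed shift_monom_closed qpoly_closed i)
    then have "- (?t i * ?q) * ?f i \<in> ?I"
      using ideal.I_l_closed[OF I fI] by (simp only: poly_ring_simps)
    from ideal_prod.prod[OF this fI, of ?R] show ?thesis
      by (simp add: poly_ring_simps)
  qed
  \<comment> \<open>The first summand is the \<open>i\<close>-th term of the relation, expressed by
    the others; the second corrects for replacing \<open>?g i - ?q * ?f i\<close> by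
    \<open>?g i\<close>.\<close>
  moreover have "of_int (b $ i) * yterm s L i ^ (nat (b $ i) - 1) * ?t i * ?f i
      = (\<Sum>j \<in> {..<s} - {i}. - (?t j * ?g j) * ?f j) + (- (?t i * ?q) * ?f i) * ?f i"
  proof -
    have "(\<Sum>j<s. ?t j * ?g j * ?f j)
        = ?t i * ?g i * ?f i + (\<Sum>j \<in> {..<s} - {i}. ?t j * ?g j * ?f j)"
      using i by (intro sum.remove) auto
    then have *: "?t i * ?g i * ?f i = (\<Sum>j \<in> {..<s} - {i}. - (?t j * ?g j) * ?f j)"
      using relation[where 'k = 'k] by (simp add: sum_negf eq_neg_iff_add_eq_0)
    have **: "of_int (b $ i) * yterm s L i ^ (nat (b $ i) - 1) = ?g i - ?q * ?f i"
      using qpoly_mult_fpoly[of b i s L, where ?'a = 'k] b_pos[OF i] by simp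
    show ?thesis
      unfolding *[symmetric] ** by (simp add: algebra_simps)
  qed
  ultimately show ?thesis
    unfolding set_add_def' poly_ring_simps by blast
qed

end

theorem proposition6p7:
  fixes s :: nat and L :: "int mat" and b :: "int vec"
  assumes "gpcb_matrix s L"
    and "b \<in> carrier_vec s" and "\<forall>i<s. b $ i > 0" and "L *\<^sub>v b = 0\<^sub>v s"
    and "Gcd (set\<^sub>v b) = 1"
    and "CHAR('k::field) > 0 \<longrightarrow> \<not> int CHAR('k) dvd b $ (s - 1)"
  shows "\<forall>i<s.
    (\<forall>j<s. shift_entry s L b i j \<ge> 0) \<and>
    shift_entry s L b i ((i + 1) mod s) = 0 \<and>
    (\<forall>d \<in> carrier_vec s. (\<forall>j<s. d $ j > 0) \<and> transpose_mat L *\<^sub>v d = 0\<^sub>v s \<longrightarrow>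
       homogeneous d (gpoly s L b i :: 'k mpoly)) \<and>
    (\<Sum>j<s. shift_monom s L b j * gpoly s L b j * fpoly s L j) = (0 :: 'k mpoly) \<and>
    (qpoly s L b i * fpoly s L i :: 'k mpoly) =
      gpoly s L b i - of_int (b $ i) * yterm s L i ^ (nat (b $ i) - 1) \<and>
    (of_int (b $ i) * yterm s L i ^ (nat (b $ i) - 1) * shift_monom s L b i * fpoly s L i
       :: 'k mpoly) \<in>
      Idl\<^bsub>poly_ring s\<^esub> (fpoly s L ` ({..<s} - {i}))
      <+>\<^bsub>poly_ring s\<^esub>
      (matrix_ideal s L \<cdot>\<^bsub>poly_ring s\<^esub> matrix_ideal s L)"
proof -
  interpret gpcb_kernel s L b
    using assms by unfold_locales auto
  show ?thesis
    using shift_entry_nonneg shift_entry_succ_self homogeneous_gpoly relation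
      qpoly_mult_fpoly b_pos membership
    by blast
qed

end
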